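(* Let $(A,\mu,\Delta,\alpha)$ be an $\epsilon$-Hom-bialgebra with balanceator $B$. Then for each integer $n\ge 1$, the balanceator $B^n$ of the $\epsilon$-Hom-bialgebra $A^n=(A,\mu^{(n)},\Delta^{(n)},\alpha^{2^n})$, where $\mu^{(n)}=\alpha^{2^n-1}\circ\mu$ and $\Delta^{(n)}=\Delta\circ\alpha^{2^n-1}$, is given by $$B^n=(\alpha^{2(2^n-1)})^{\otimes 2}\circ B.$$ In particular, if $B$ is symmetric, then so is $B^n$. Conversely, if $B^n$ is symmetric for some $n$ and $\alpha^{\otimes 2}$ is injective, then $B$ is symmetric.
   Context: Throughout, $\mathbf{k}$ is a fixed field of characteristic $0$; vector spaces, linear maps and tensor products are over $\mathbf{k}$. $\tau$ denotes the twist $\tau(x\otimes y)=y\otimes x$; for a linear self-map $f$, $f^m$ denotes its $m$-fold composition. (The superscript in $B^n$ is only a label for the balanceator of $A^n$, not a composition power.) An $\epsilon$-Hom-bialgebra $(A,\mu,\Delta,\alpha)$ is a $\mathbf{k}$-vector space $A$ with linear maps $\mu\colon A^{\otimes 2}\to A$, $\Delta\colon A\to A^{\otimes 2}$, $\alpha\colon A\to A$ such that: $\alpha\circ\mu=\mu\circ\alpha^{\otimes 2}$; $\mu\circ(\alpha\otimes\mu)=\mu\circ(\mu\otimes\alpha)$; $\alpha^{\otimes 2}\circ\Delta=\Delta\circ\alpha$; $(\alpha\otimes\Delta)\circ\Delta=(\Delta\otimes\alpha)\circ\Delta$; and $\Delta\circ\mu=(\mu\otimes\alpha)\circ(\alpha\otimes\Delta)+(\alpha\otimes\mu)\circ(\Delta\otimes\alpha)$.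 If $A$ is an $\epsilon$-Hom-bialgebra, then so is each $A^n$ (the $n$th derived $\epsilon$-Hom-bialgebra of $A$). In an $\epsilon$-Hom-bialgebra $(A,\mu,\Delta,\alpha)$, for $a\in A$ and $b=\sum b_1\otimes b_2\in A^{\otimes 2}$, set $[a,b]_\bullet=\sum\mu(\alpha(a),b_1)\otimes\alpha(b_2)-\alpha(b_1)\otimes\mu(b_2,\alpha(a))$. With $\Delta^{op}=\tau\circ\Delta$, the balanceator is the map $B\colon A^{\otimes 2}\to A^{\otimes 2}$, $$B(x,y)=[x,\Delta^{op}(y)]_\bullet+\tau([y,\Delta^{op}(x)]_\bullet),$$ all formed with the structure maps of the $\epsilon$-Hom-bialgebra in question. The balanceator is symmetric if $B(x,y)=B(y,x)$ for all $x,y\in A$. *)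

theory Defs
  imports "Jordan_Normal_Form.Missing_VectorSpace" "HOL-Algebra.AbelCoset"
begin

text \<open>
  Vector spaces are \<open>vectorspace K V\<close> over a field record \<open>K\<close>, and linear maps are the
  elements of \<open>module_hom K V W\<close> (so their values outside \<open>carrier V\<close> are irrelevant).
  The fields \<open>mult\<close> and \<open>one\<close> of a module record carry no meaning.
\<close>

definition free_vs :: "('k, 'm) ring_scheme \<Rightarrow> 'x set \<Rightarrow> ('k, 'x \<Rightarrow> 'k) module" where
  "free_vs K X = (ring.func_space K X)
     \<lparr>carrier := {f \<in> X \<rightarrow>\<^sub>E carrier K. finite {x \<in> X. f x \<noteq> \<zero>\<^bsub>K\<^esub>}}\<rparr>"

definition free_gen :: "('k, 'm) ring_scheme \<Rightarrow> 'x set \<Rightarrow> 'x \<Rightarrow> 'x \<Rightarrow> 'k" where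
  "free_gen K X x = (\<lambda>y\<in>X. if y = x then \<one>\<^bsub>K\<^esub> else \<zero>\<^bsub>K\<^esub>)"

text \<open>
  For \<open>c = 0\<close> the set \<open>{c \<odot> v | v \<in> C}\<close> is not a coset, so scalar multiplication on
  cosets adds \<open>N\<close>.
\<close>

definition quotient_vs :: "('k, 'v, 'm) module_scheme \<Rightarrow> 'v set \<Rightarrow> ('k, 'v set) module" where
  "quotient_vs V N =
     \<lparr>carrier = a_rcosets\<^bsub>V\<^esub> N, mult = (\<lambda>_ _. N), one = N, zero = N, add = set_add V,
      smult = (\<lambda>c C. \<Union>v\<in>C. N +>\<^bsub>V\<^esub> (c \<odot>\<^bsub>V\<^esub> v))\<rparr>"

definition tensor_rels ::
  "('k, 'm) ring_scheme \<Rightarrow> ('k, 'v, 'm1) module_scheme \<Rightarrow> ('k, 'w, 'm2) module_scheme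
    \<Rightarrow> ('v \<times> 'w \<Rightarrow> 'k) set" where
  "tensor_rels K V W =
    (let F = free_vs K (carrier V \<times> carrier W);
         e = (\<lambda>v w. free_gen K (carrier V \<times> carrier W) (v, w))
     in {e (v \<oplus>\<^bsub>V\<^esub> v') w \<ominus>\<^bsub>F\<^esub> (e v w \<oplus>\<^bsub>F\<^esub> e v' w) | v v' w.
           v \<in> carrier V \<and> v' \<in> carrier V \<and> w \<in> carrier W}
      \<union> {e v (w \<oplus>\<^bsub>W\<^esub> w') \<ominus>\<^bsub>F\<^esub> (e v w \<oplus>\<^bsub>F\<^esub> e v w') | v w w'.
           v \<in> carrier V \<and> w \<in> carrier W \<and> w' \<in> carrier W}
      \<union> {e (c \<odot>\<^bsub>V\<^esub> v) w \<ominus>\<^bsub>F\<^esub> (c \<odot>\<^bsub>F\<^esub> e v w) | c v w.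
           c \<in> carrier K \<and> v \<in> carrier V \<and> w \<in> carrier W}
      \<union> {e v (c \<odot>\<^bsub>W\<^esub> w) \<ominus>\<^bsub>F\<^esub> (c \<odot>\<^bsub>F\<^esub> e v w) | c v w.
           c \<in> carrier K \<and> v \<in> carrier V \<and> w \<in> carrier W})"

definition tensor_null ::
  "('k, 'm) ring_scheme \<Rightarrow> ('k, 'v, 'm1) module_scheme \<Rightarrow> ('k, 'w, 'm2) module_scheme
    \<Rightarrow> ('v \<times> 'w \<Rightarrow> 'k) set" where
  "tensor_null K V W =
     module.span K (free_vs K (carrier V \<times> carrier W)) (tensor_rels K V W)"

definition tensor ::
  "('k, 'm) ring_scheme \<Rightarrow> ('k, 'v, 'm1) module_scheme \<Rightarrow> ('k, 'w, 'm2) module_scheme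
    \<Rightarrow> ('k, ('v \<times> 'w \<Rightarrow> 'k) set) module" where
  "tensor K V W = quotient_vs (free_vs K (carrier V \<times> carrier W)) (tensor_null K V W)"

definition tens ::
  "('k, 'm) ring_scheme \<Rightarrow> ('k, 'v, 'm1) module_scheme \<Rightarrow> ('k, 'w, 'm2) module_scheme
    \<Rightarrow> 'v \<Rightarrow> 'w \<Rightarrow> ('v \<times> 'w \<Rightarrow> 'k) set" where
  "tens K V W v w =
     tensor_null K V W +>\<^bsub>free_vs K (carrier V \<times> carrier W)\<^esub>
       free_gen K (carrier V \<times> carrier W) (v, w)"

definition bilinear_map ::
  "('k, 'm) ring_scheme \<Rightarrow> ('k, 'v, 'm1) module_scheme \<Rightarrow> ('k, 'w, 'm2) module_scheme
    \<Rightarrow> ('k, 'u, 'm3) module_scheme \<Rightarrow> ('v \<Rightarrow> 'w \<Rightarrow> 'u) \<Rightarrow> bool" where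
  "bilinear_map K V W U \<phi> \<longleftrightarrow>
     (\<forall>w\<in>carrier W. (\<lambda>v. \<phi> v w) \<in> module_hom K V U) \<and>
     (\<forall>v\<in>carrier V. \<phi> v \<in> module_hom K W U)"

text \<open>
  The linear map on \<open>tensor K V W\<close> induced by a bilinear map \<open>\<phi>\<close>. The description is
  only meaningful for bilinear \<open>\<phi>\<close>; extensionality makes the map unique
  (see \<open>tensor_lift_hom\<close>, \<open>tensor_lift_tens\<close> and \<open>tensor_hom_eqI\<close>).
\<close>

definition tensor_lift ::
  "('k, 'm) ring_scheme \<Rightarrow> ('k, 'v, 'm1) module_scheme \<Rightarrow> ('k, 'w, 'm2) module_scheme
    \<Rightarrow> ('k, 'u, 'm3) module_scheme \<Rightarrow> ('v \<Rightarrow> 'w \<Rightarrow> 'u) \<Rightarrow> ('v \<times> 'w \<Rightarrow> 'k) set \<Rightarrow> 'u" where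
  "tensor_lift K V W U \<phi> =
    (THE h. h \<in> module_hom K (tensor K V W) U \<and> h \<in> extensional (carrier (tensor K V W)) \<and>
            (\<forall>v\<in>carrier V. \<forall>w\<in>carrier W. h (tens K V W v w) = \<phi> v w))"

lemma free_vs_simps:
  assumes "cring K"
  shows "carrier (free_vs K X) = {f \<in> X \<rightarrow>\<^sub>E carrier K. finite {x \<in> X. f x \<noteq> \<zero>\<^bsub>K\<^esub>}}"
    and "add (free_vs K X) = (\<lambda>f g. \<lambda>x\<in>X. f x \<oplus>\<^bsub>K\<^esub> g x)"
    and "zero (free_vs K X) = (\<lambda>x\<in>X. \<zero>\<^bsub>K\<^esub>)"
    and "smult (free_vs K X) = (\<lambda>c f. \<lambda>x\<in>X. c \<otimes>\<^bsub>K\<^esub> f x)"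
  using assms by (simp_all add: free_vs_def ring.func_space_def cring_def)

lemma free_vs_module:
  assumes K: "cring K"
  shows "module K (free_vs K X)"
proof -
  interpret K: cring K by (rule K)
  interpret F: module K "K.func_space X" by (rule K.func_space_is_module)
  let ?S = "{f \<in> X \<rightarrow>\<^sub>E carrier K. finite {x \<in> X. f x \<noteq> \<zero>\<^bsub>K\<^esub>}}"
  have "submodule K ?S (K.func_space X)"
  proof (rule submodule.intro)
    show "module K (K.func_space X)" by (rule F.module_axioms)
    show "?S \<subseteq> carrier (K.func_space X)" by (auto simp: K.func_space_def)
    show "\<zero>\<^bsub>K.func_space X\<^esub> \<in> ?S" by (auto simp: K.func_space_def)
  next
    fix v w assume *: "v \<in> ?S" "w \<in> ?S"
    have "{x \<in> X. v x \<oplus>\<^bsub>K\<^esub> w x \<noteq> \<zero>\<^bsub>K\<^esub>} \<subseteq> {x \<in> X. v x \<noteq> \<zero>\<^bsub>K\<^esub>} \<union> {x \<in> X. w x \<noteq> \<zero>\<^bsub>K\<^esub>}"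
      using * by auto
    moreover have "finite ..." using * by simp
    ultimately have "finite {x \<in> X. v x \<oplus>\<^bsub>K\<^esub> w x \<noteq> \<zero>\<^bsub>K\<^esub>}" by (rule finite_subset)
    moreover have "(\<lambda>x\<in>X. v x \<oplus>\<^bsub>K\<^esub> w x) \<in> X \<rightarrow>\<^sub>E carrier K" using * by (auto simp: PiE_def Pi_def)
    ultimately show "v \<oplus>\<^bsub>K.func_space X\<^esub> w \<in> ?S" by (simp add: K.func_space_def cong: conj_cong)
  next
    fix c v assume *: "c \<in> carrier K" "v \<in> ?S"
    have "{x \<in> X. c \<otimes>\<^bsub>K\<^esub> v x \<noteq> \<zero>\<^bsub>K\<^esub>} \<subseteq> {x \<in> X. v x \<noteq> \<zero>\<^bsub>K\<^esub>}"
      using * by auto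
    moreover have "finite ..." using * by simp
    ultimately have "finite {x \<in> X. c \<otimes>\<^bsub>K\<^esub> v x \<noteq> \<zero>\<^bsub>K\<^esub>}" by (rule finite_subset)
    moreover have "(\<lambda>x\<in>X. c \<otimes>\<^bsub>K\<^esub> v x) \<in> X \<rightarrow>\<^sub>E carrier K" using * by (auto simp: PiE_def Pi_def)
    ultimately show "c \<odot>\<^bsub>K.func_space X\<^esub> v \<in> ?S" by (simp add: K.func_space_def cong: conj_cong)
  qed
  then show ?thesis
    using F.submodule_is_module by (simp add: free_vs_def)
qed

lemma free_gen_carrier:
  assumes "cring K" "x \<in> X"
  shows "free_gen K X x \<in> carrier (free_vs K X)"
proof -
  interpret K: cring K by (rule assms)
  have "{y \<in> X. free_gen K X x y \<noteq> \<zero>\<^bsub>K\<^esub>} \<subseteq> {x}" by (auto simp: free_gen_def)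
  then have "finite {y \<in> X. free_gen K X x y \<noteq> \<zero>\<^bsub>K\<^esub>}" using finite_subset by blast
  then show ?thesis by (auto simp: free_vs_simps[OF assms(1)] free_gen_def)
qed

lemma free_vs_hom_eqI:
  assumes K: "cring K" and U: "module K U"
    and g: "g \<in> module_hom K (free_vs K X) U" and h: "h \<in> module_hom K (free_vs K X) U"
    and eq: "\<And>x. x \<in> X \<Longrightarrow> g (free_gen K X x) = h (free_gen K X x)"
    and f: "f \<in> carrier (free_vs K X)"
  shows "g f = h f"
proof -
  interpret K: cring K by (rule K)
  interpret F: module K "free_vs K X" by (rule free_vs_module[OF K])
  interpret U: module K U by (rule U)
  interpret g: mod_hom K "free_vs K X" U g by unfold_locales (rule g)
  interpret h: mod_hom K "free_vs K X" U h by unfold_locales (rule h)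
  note S = free_vs_simps[OF K, of X]
  have "f \<in> carrier (free_vs K X) \<Longrightarrow> {x \<in> X. f x \<noteq> \<zero>\<^bsub>K\<^esub>} \<subseteq> T \<Longrightarrow> T \<subseteq> X \<Longrightarrow> g f = h f"
    if "finite T" for T f
    using that
  proof (induction T arbitrary: f)
    case empty
    have "f = \<zero>\<^bsub>free_vs K X\<^esub>"
      using empty by (auto simp: S PiE_def extensional_def fun_eq_iff)
    then show ?case by simp
  next
    case (insert x T)
    let ?f = "\<lambda>y\<in>X. if y = x then \<zero>\<^bsub>K\<^esub> else f y"
    have x: "x \<in> X" using insert by simp
    have fx: "f x \<in> carrier K" using insert x by (auto simp: S)
    have "{y \<in> X. ?f y \<noteq> \<zero>\<^bsub>K\<^esub>} \<subseteq> {y \<in> X. f y \<noteq> \<zero>\<^bsub>K\<^esub>}" by auto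
    moreover have "finite ..." using insert.prems by (simp add: S)
    ultimately have "finite {y \<in> X. ?f y \<noteq> \<zero>\<^bsub>K\<^esub>}" by (rule finite_subset)
    moreover have "?f \<in> X \<rightarrow>\<^sub>E carrier K" using insert.prems by (auto simp: S)
    ultimately have fc: "?f \<in> carrier (free_vs K X)" unfolding S by blast
    have "{y \<in> X. ?f y \<noteq> \<zero>\<^bsub>K\<^esub>} \<subseteq> T" using insert.prems by auto
    with fc insert have IH: "g ?f = h ?f" by blast
    have gx: "free_gen K X x \<in> carrier (free_vs K X)" by (rule free_gen_carrier[OF K x])
    have dec: "f = (f x \<odot>\<^bsub>free_vs K X\<^esub> free_gen K X x) \<oplus>\<^bsub>free_vs K X\<^esub> ?f"
    proof
      fix y
      show "f y = ((f x \<odot>\<^bsub>free_vs K X\<^esub> free_gen K X x) \<oplus>\<^bsub>free_vs K X\<^esub> ?f) y"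
      proof (cases "y \<in> X")
        case True
        then have "f y \<in> carrier K" using insert.prems by (auto simp: S)
        with True fx show ?thesis by (auto simp: S free_gen_def)
      next
        case False
        then show ?thesis using insert.prems by (auto simp: S PiE_def extensional_def)
      qed
    qed
    have cx: "f x \<odot>\<^bsub>free_vs K X\<^esub> free_gen K X x \<in> carrier (free_vs K X)" using fx gx by simp
    have "g f = f x \<odot>\<^bsub>U\<^esub> g (free_gen K X x) \<oplus>\<^bsub>U\<^esub> g ?f"
      by (subst dec) (simp only: g.f_add[OF cx fc] g.f_smult[OF fx gx])
    also have "\<dots> = f x \<odot>\<^bsub>U\<^esub> h (free_gen K X x) \<oplus>\<^bsub>U\<^esub> h ?f" using IH eq[OF x] by simp
    also have "\<dots> = h f"
      by (subst (2) dec) (simp only: h.f_add[OF cx fc] h.f_smult[OF fx gx])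
    finally show ?case .
  qed
  from this[of "{x \<in> X. f x \<noteq> \<zero>\<^bsub>K\<^esub>}" f] f show ?thesis by (auto simp: S)
qed

lemma free_vs_hom_exists:
  assumes K: "cring K" and U: "module K U" and \<phi>: "\<And>x. x \<in> X \<Longrightarrow> \<phi> x \<in> carrier U"
  shows "\<exists>h \<in> module_hom K (free_vs K X) U. \<forall>x\<in>X. h (free_gen K X x) = \<phi> x"
proof -
  interpret K: cring K by (rule K)
  interpret F: module K "free_vs K X" by (rule free_vs_module[OF K])
  interpret U: module K U by (rule U)
  note S = free_vs_simps[OF K, of X]
  define h where "h f = (\<Oplus>\<^bsub>U\<^esub>x\<in>{x \<in> X. f x \<noteq> \<zero>\<^bsub>K\<^esub>}. f x \<odot>\<^bsub>U\<^esub> \<phi> x)" for f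
  have val: "f x \<in> carrier K" if "f \<in> carrier (free_vs K X)" "x \<in> X" for f x
    using that by (auto simp: S)
  have h: "h f = (\<Oplus>\<^bsub>U\<^esub>x\<in>T. f x \<odot>\<^bsub>U\<^esub> \<phi> x)"
    if "f \<in> carrier (free_vs K X)" "finite T" "{x \<in> X. f x \<noteq> \<zero>\<^bsub>K\<^esub>} \<subseteq> T" "T \<subseteq> X" for f T
    unfolding h_def using that val \<phi>
    by (intro U.M.add.finprod_mono_neutral_cong_left) (auto simp: subset_iff)
  have supp: "finite {x \<in> X. f x \<noteq> \<zero>\<^bsub>K\<^esub>}" if "f \<in> carrier (free_vs K X)" for f
    using that by (simp add: S)
  have "h \<in> module_hom K (free_vs K X) U"
    unfolding module_hom_def
  proof (intro CollectI conjI allI impI funcsetI)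
    fix f assume f: "f \<in> carrier (free_vs K X)"
    then show "h f \<in> carrier U" unfolding h_def using val \<phi> by (intro U.finsum_closed) auto
  next
    fix f g assume "f \<in> carrier (free_vs K X) \<and> g \<in> carrier (free_vs K X)"
    then have f: "f \<in> carrier (free_vs K X)" and g: "g \<in> carrier (free_vs K X)" by auto
    then have fg: "f \<oplus>\<^bsub>free_vs K X\<^esub> g \<in> carrier (free_vs K X)" by simp
    let ?T = "{x \<in> X. f x \<noteq> \<zero>\<^bsub>K\<^esub>} \<union> {x \<in> X. g x \<noteq> \<zero>\<^bsub>K\<^esub>}"
    have T: "finite ?T" "?T \<subseteq> X" using supp f g by auto
    have "h (f \<oplus>\<^bsub>free_vs K X\<^esub> g) = (\<Oplus>\<^bsub>U\<^esub>x\<in>?T. (f \<oplus>\<^bsub>free_vs K X\<^esub> g) x \<odot>\<^bsub>U\<^esub> \<phi> x)"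
      by (rule h[OF fg T(1) _ T(2)]) (auto simp: S)
    also have "\<dots> = (\<Oplus>\<^bsub>U\<^esub>x\<in>?T. f x \<odot>\<^bsub>U\<^esub> \<phi> x \<oplus>\<^bsub>U\<^esub> g x \<odot>\<^bsub>U\<^esub> \<phi> x)"
      using val[OF f] val[OF g] \<phi>
      by (intro U.finsum_cong') (auto simp: S U.smult_l_distr)
    also have "\<dots> = (\<Oplus>\<^bsub>U\<^esub>x\<in>?T. f x \<odot>\<^bsub>U\<^esub> \<phi> x) \<oplus>\<^bsub>U\<^esub> (\<Oplus>\<^bsub>U\<^esub>x\<in>?T. g x \<odot>\<^bsub>U\<^esub> \<phi> x)"
      using val[OF f] val[OF g] \<phi> by (intro U.finsum_addf) auto
    also have "\<dots> = h f \<oplus>\<^bsub>U\<^esub> h g"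
      using h[OF f T(1) _ T(2)] h[OF g T(1) _ T(2)] by auto
    finally show "h (f \<oplus>\<^bsub>free_vs K X\<^esub> g) = h f \<oplus>\<^bsub>U\<^esub> h g" .
  next
    fix c f assume "c \<in> carrier K \<and> f \<in> carrier (free_vs K X)"
    then have c: "c \<in> carrier K" and f: "f \<in> carrier (free_vs K X)" by auto
    then have cf: "c \<odot>\<^bsub>free_vs K X\<^esub> f \<in> carrier (free_vs K X)" by simp
    let ?T = "{x \<in> X. f x \<noteq> \<zero>\<^bsub>K\<^esub>}"
    have T: "finite ?T" "?T \<subseteq> X" using supp f by auto
    have "h (c \<odot>\<^bsub>free_vs K X\<^esub> f) = (\<Oplus>\<^bsub>U\<^esub>x\<in>?T. (c \<odot>\<^bsub>free_vs K X\<^esub> f) x \<odot>\<^bsub>U\<^esub> \<phi> x)"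
      using c by (intro h[OF cf T(1) _ T(2)]) (auto simp: S)
    also have "\<dots> = (\<Oplus>\<^bsub>U\<^esub>x\<in>?T. c \<odot>\<^bsub>U\<^esub> (f x \<odot>\<^bsub>U\<^esub> \<phi> x))"
      using val[OF f] c \<phi> by (intro U.finsum_cong') (auto simp: S U.smult_assoc1)
    also have "\<dots> = c \<odot>\<^bsub>U\<^esub> (\<Oplus>\<^bsub>U\<^esub>x\<in>?T. f x \<odot>\<^bsub>U\<^esub> \<phi> x)"
      using val[OF f] c \<phi> T by (intro U.finsum_smult_ldistr[symmetric]) auto
    finally show "h (c \<odot>\<^bsub>free_vs K X\<^esub> f) = c \<odot>\<^bsub>U\<^esub> h f" by (simp add: h_def)
  qed
  moreover have "h (free_gen K X x) = \<phi> x" if x: "x \<in> X" for x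
  proof -
    have "h (free_gen K X x) = (\<Oplus>\<^bsub>U\<^esub>y\<in>{x}. free_gen K X x y \<odot>\<^bsub>U\<^esub> \<phi> y)"
      by (rule h[OF free_gen_carrier[OF K x]]) (use x in \<open>auto simp: free_gen_def\<close>)
    also have "\<dots> = \<phi> x" using x \<phi> by (simp add: free_gen_def)
    finally show ?thesis .
  qed
  ultimately show ?thesis by blast
qed

lemma submodule_abelian_subgroup:
  assumes V: "module K V" and N: "submodule K N V"
  shows "abelian_subgroup N V"
proof -
  interpret V: module K V by (rule V)
  interpret N: submodule K N V by (rule N)
  have "\<ominus>\<^bsub>V\<^esub> x \<in> N" if "x \<in> N" for x
    using that N.smult_closed[of "\<ominus>\<^bsub>K\<^esub> \<one>\<^bsub>K\<^esub>" x] N.subset V.smult_minus_1[of x]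
    by (metis V.R.add.inv_closed V.R.one_closed subsetD)
  then have "subgroup N (add_monoid V)"
    using N.subset N.zero_closed by (intro V.add.subgroupI) (auto simp del: N.zero_closed)
  then show ?thesis
    by (intro abelian_subgroupI3 additive_subgroup.intro V.abelian_group_axioms)
qed

lemma quotient_vs_facts:
  assumes V: "module K V" and N: "submodule K N V"
  shows quotient_vs_module: "module K (quotient_vs V N)"
    and quotient_vs_proj: "(\<lambda>x. N +>\<^bsub>V\<^esub> x) \<in> module_hom K V (quotient_vs V N)"
    and quotient_vs_carrier: "carrier (quotient_vs V N) = (\<lambda>x. N +>\<^bsub>V\<^esub> x) ` carrier V"
proof -
  interpret V: module K V by (rule V)
  interpret N: submodule K N V by (rule N)
  interpret N': abelian_subgroup N V by (rule submodule_abelian_subgroup[OF V N])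
  let ?Q = "quotient_vs V N" and ?p = "\<lambda>x. N +>\<^bsub>V\<^esub> x"
  show car: "carrier ?Q = ?p ` carrier V"
    by (auto simp: quotient_vs_def A_RCOSETS_def' )
  have add: "?p x \<oplus>\<^bsub>?Q\<^esub> ?p y = ?p (x \<oplus>\<^bsub>V\<^esub> y)" if "x \<in> carrier V" "y \<in> carrier V" for x y
    using that by (simp add: quotient_vs_def N'.a_rcos_sum)
  have zero: "\<zero>\<^bsub>?Q\<^esub> = ?p \<zero>\<^bsub>V\<^esub>" using N.subset by (simp add: quotient_vs_def)
  have smult: "c \<odot>\<^bsub>?Q\<^esub> ?p x = ?p (c \<odot>\<^bsub>V\<^esub> x)" if c: "c \<in> carrier K" and x: "x \<in> carrier V" for c x
  proof -
    have "?p (c \<odot>\<^bsub>V\<^esub> v) = ?p (c \<odot>\<^bsub>V\<^esub> x)" if v: "v \<in> ?p x" for v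
    proof -
      obtain n where n: "n \<in> N" "v = n \<oplus>\<^bsub>V\<^esub> x" using v by (auto simp: a_r_coset_def')
      then have "c \<odot>\<^bsub>V\<^esub> v = c \<odot>\<^bsub>V\<^esub> n \<oplus>\<^bsub>V\<^esub> c \<odot>\<^bsub>V\<^esub> x"
        using c x N.subset by (auto intro: V.smult_r_distr)
      then have "c \<odot>\<^bsub>V\<^esub> v \<in> ?p (c \<odot>\<^bsub>V\<^esub> x)" using n c by (auto simp: a_r_coset_def')
      with c x show ?thesis using N'.a_repr_independence'[of _ "c \<odot>\<^bsub>V\<^esub> x"] by simp
    qed
    moreover have "x \<in> ?p x" using x by (rule N'.a_rcos_self)
    ultimately have "(\<Union>v\<in>?p x. ?p (c \<odot>\<^bsub>V\<^esub> v)) = ?p (c \<odot>\<^bsub>V\<^esub> x)" by blast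
    then show ?thesis by (simp add: quotient_vs_def)
  qed
  show "module K ?Q"
  proof (rule module_criteria[OF V.R.cring_axioms])
    show "\<forall>v\<in>carrier ?Q. \<exists>w\<in>carrier ?Q. v \<oplus>\<^bsub>?Q\<^esub> w = \<zero>\<^bsub>?Q\<^esub>"
    proof
      fix v assume "v \<in> carrier ?Q"
      then obtain x where x: "x \<in> carrier V" "v = ?p x" by (auto simp: car)
      then have "?p (\<ominus>\<^bsub>V\<^esub> x) \<in> carrier ?Q" "v \<oplus>\<^bsub>?Q\<^esub> ?p (\<ominus>\<^bsub>V\<^esub> x) = \<zero>\<^bsub>?Q\<^esub>"
        by (auto simp: car add zero V.M.r_neg)
      then show "\<exists>w\<in>carrier ?Q. v \<oplus>\<^bsub>?Q\<^esub> w = \<zero>\<^bsub>?Q\<^esub>" by blast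
    qed
  qed (auto simp: car add zero smult V.M.a_assoc V.smult_assoc1 V.smult_l_distr V.smult_r_distr
        V.M.a_ac)
  show "?p \<in> module_hom K V ?Q"
    by (auto simp: module_hom_def car add smult)
qed

lemma tensor_rels_null:
  assumes K: "cring K" and V: "module K V" and W: "module K W"
  shows tensor_rels_carrier: "tensor_rels K V W \<subseteq> carrier (free_vs K (carrier V \<times> carrier W))"
    and tensor_null_submodule:
      "submodule K (tensor_null K V W) (free_vs K (carrier V \<times> carrier W))"
    and tensor_rels_subset_null: "tensor_rels K V W \<subseteq> tensor_null K V W"
proof -
  interpret K: cring K by (rule K)
  interpret V: module K V by (rule V)
  interpret W: module K W by (rule W)
  let ?X = "carrier V \<times> carrier W"
  interpret F: module K "free_vs K ?X" by (rule free_vs_module[OF K])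
  have [simp]: "free_gen K ?X (v, w) \<in> carrier (free_vs K ?X)"
    if "v \<in> carrier V" "w \<in> carrier W" for v w
    using that by (auto intro: free_gen_carrier[OF K])
  show *: "tensor_rels K V W \<subseteq> carrier (free_vs K ?X)"
    by (auto simp: tensor_rels_def Let_def)
  show "submodule K (tensor_null K V W) (free_vs K ?X)"
    unfolding tensor_null_def by (rule F.span_is_submodule[OF *])
  show "tensor_rels K V W \<subseteq> tensor_null K V W"
    unfolding tensor_null_def by (rule F.in_own_span[OF *])
qed

lemma tensor_module:
  assumes "cring K" "module K V" "module K W"
  shows "module K (tensor K V W)"
  unfolding tensor_def
  by (rule quotient_vs_module[OF free_vs_module[OF assms(1)] tensor_null_submodule[OF assms]])

lemma tens_bilinear:
  assumes K: "cring K" and V: "module K V" and W: "module K W"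
  shows "bilinear_map K V W (tensor K V W) (tens K V W)"
proof -
  interpret V: module K V by (rule V)
  interpret W: module K W by (rule W)
  let ?X = "carrier V \<times> carrier W"
  let ?F = "free_vs K ?X"
  let ?N = "tensor_null K V W"
  let ?e = "\<lambda>v w. free_gen K ?X (v, w)"
  let ?p = "\<lambda>x. ?N +>\<^bsub>?F\<^esub> x"
  interpret F: module K ?F by (rule free_vs_module[OF K])
  interpret N: abelian_subgroup ?N ?F
    by (rule submodule_abelian_subgroup[OF F.module_axioms tensor_null_submodule[OF assms]])
  interpret T: module K "tensor K V W" by (rule tensor_module[OF assms])
  have p: "?p \<in> module_hom K ?F (tensor K V W)"
    unfolding tensor_def
    by (rule quotient_vs_proj[OF F.module_axioms tensor_null_submodule[OF assms]])
  interpret p: mod_hom K ?F "tensor K V W" ?p by unfold_locales (rule p)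
  have e: "?e v w \<in> carrier ?F" if "v \<in> carrier V" "w \<in> carrier W" for v w
    using that by (auto intro: free_gen_carrier[OF K])
  have eqI: "?p x = ?p y"
    if "x \<in> carrier ?F" "y \<in> carrier ?F" "x \<ominus>\<^bsub>?F\<^esub> y \<in> tensor_rels K V W" for x y
  proof -
    have "x \<ominus>\<^bsub>?F\<^esub> y \<in> ?N" using that tensor_rels_subset_null[OF assms] by blast
    then have "x \<in> ?p y"
      using that by (auto simp: a_r_coset_def' F.M.a_assoc F.M.l_neg a_minus_def
          intro!: bexI[of _ "x \<ominus>\<^bsub>?F\<^esub> y"])
    then show ?thesis using N.a_repr_independence' that by metis
  qed
  have t: "tens K V W v w = ?p (?e v w)" for v w by (simp add: tens_def)
  have c: "tens K V W v w \<in> carrier (tensor K V W)" if "v \<in> carrier V" "w \<in> carrier W" for v w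
    unfolding t using e[OF that] by (rule p.f_im)
  have 1: "tens K V W (v \<oplus>\<^bsub>V\<^esub> v') w = tens K V W v w \<oplus>\<^bsub>tensor K V W\<^esub> tens K V W v' w"
    if "v \<in> carrier V" "v' \<in> carrier V" "w \<in> carrier W" for v v' w
  proof -
    have "?e (v \<oplus>\<^bsub>V\<^esub> v') w \<ominus>\<^bsub>?F\<^esub> (?e v w \<oplus>\<^bsub>?F\<^esub> ?e v' w) \<in> tensor_rels K V W"
      unfolding tensor_rels_def Let_def using that by blast
    then have "?p (?e (v \<oplus>\<^bsub>V\<^esub> v') w) = ?p (?e v w \<oplus>\<^bsub>?F\<^esub> ?e v' w)"
      by (intro eqI) (simp_all add: e that)
    then show ?thesis unfolding t by (simp only: p.f_add[OF e e] that)
  qed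
  have 2: "tens K V W v (w \<oplus>\<^bsub>W\<^esub> w') = tens K V W v w \<oplus>\<^bsub>tensor K V W\<^esub> tens K V W v w'"
    if "v \<in> carrier V" "w \<in> carrier W" "w' \<in> carrier W" for v w w'
  proof -
    have "?e v (w \<oplus>\<^bsub>W\<^esub> w') \<ominus>\<^bsub>?F\<^esub> (?e v w \<oplus>\<^bsub>?F\<^esub> ?e v w') \<in> tensor_rels K V W"
      unfolding tensor_rels_def Let_def using that by blast
    then have "?p (?e v (w \<oplus>\<^bsub>W\<^esub> w')) = ?p (?e v w \<oplus>\<^bsub>?F\<^esub> ?e v w')"
      by (intro eqI) (simp_all add: e that)
    then show ?thesis unfolding t by (simp only: p.f_add[OF e e] that)
  qed
  have 3: "tens K V W (c \<odot>\<^bsub>V\<^esub> v) w = c \<odot>\<^bsub>tensor K V W\<^esub> tens K V W v w"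
    if "c \<in> carrier K" "v \<in> carrier V" "w \<in> carrier W" for c v w
  proof -
    have "?e (c \<odot>\<^bsub>V\<^esub> v) w \<ominus>\<^bsub>?F\<^esub> (c \<odot>\<^bsub>?F\<^esub> ?e v w) \<in> tensor_rels K V W"
      unfolding tensor_rels_def Let_def using that by blast
    then have "?p (?e (c \<odot>\<^bsub>V\<^esub> v) w) = ?p (c \<odot>\<^bsub>?F\<^esub> ?e v w)"
      by (intro eqI) (simp_all add: e that)
    then show ?thesis unfolding t by (simp only: p.f_smult[OF _ e] that)
  qed
  have 4: "tens K V W v (c \<odot>\<^bsub>W\<^esub> w) = c \<odot>\<^bsub>tensor K V W\<^esub> tens K V W v w"
    if "c \<in> carrier K" "v \<in> carrier V" "w \<in> carrier W" for c v w
  proof -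
    have "?e v (c \<odot>\<^bsub>W\<^esub> w) \<ominus>\<^bsub>?F\<^esub> (c \<odot>\<^bsub>?F\<^esub> ?e v w) \<in> tensor_rels K V W"
      unfolding tensor_rels_def Let_def using that by blast
    then have "?p (?e v (c \<odot>\<^bsub>W\<^esub> w)) = ?p (c \<odot>\<^bsub>?F\<^esub> ?e v w)"
      by (intro eqI) (simp_all add: e that)
    then show ?thesis unfolding t by (simp only: p.f_smult[OF _ e] that)
  qed
  show ?thesis
    using c 1 2 3 4 by (auto simp: bilinear_map_def module_hom_def)
qed

lemma tensor_hom_eqI:
  assumes K: "cring K" and V: "module K V" and W: "module K W" and U: "module K U"
    and g: "g \<in> module_hom K (tensor K V W) U" and h: "h \<in> module_hom K (tensor K V W) U"
    and eq: "\<And>v w. v \<in> carrier V \<Longrightarrow> w \<in> carrier W \<Longrightarrow> g (tens K V W v w) = h (tens K V W v w)"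
    and t: "t \<in> carrier (tensor K V W)"
  shows "g t = h t"
proof -
  let ?X = "carrier V \<times> carrier W"
  let ?F = "free_vs K ?X"
  let ?N = "tensor_null K V W"
  let ?p = "\<lambda>x. ?N +>\<^bsub>?F\<^esub> x"
  note F = free_vs_module[OF K, of ?X]
  have p: "?p \<in> module_hom K ?F (tensor K V W)"
    unfolding tensor_def by (rule quotient_vs_proj[OF F tensor_null_submodule[OF K V W]])
  have comp: "(\<lambda>x. k (?p x)) \<in> module_hom K ?F U" if "k \<in> module_hom K (tensor K V W) U" for k
    using p that by (auto simp: module_hom_def Pi_def)
  obtain x where x: "x \<in> carrier ?F" "t = ?p x"
    using t by (auto simp: tensor_def quotient_vs_carrier[OF F tensor_null_submodule[OF K V W]])
  have "g (?p x) = h (?p x)"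
    by (rule free_vs_hom_eqI[OF K U comp[OF g] comp[OF h] _ x(1)])
      (use eq in \<open>auto simp: tens_def\<close>)
  with x show ?thesis by simp
qed

lemma tensor_hom_exists:
  assumes K: "cring K" and V: "module K V" and W: "module K W" and U: "module K U"
    and \<phi>: "bilinear_map K V W U \<phi>"
  shows "\<exists>h \<in> module_hom K (tensor K V W) U.
           \<forall>v\<in>carrier V. \<forall>w\<in>carrier W. h (tens K V W v w) = \<phi> v w"
proof -
  interpret V: module K V by (rule V)
  interpret W: module K W by (rule W)
  interpret U: module K U by (rule U)
  let ?X = "carrier V \<times> carrier W"
  let ?F = "free_vs K ?X"
  let ?N = "tensor_null K V W"
  let ?e = "\<lambda>v w. free_gen K ?X (v, w)"
  let ?p = "\<lambda>x. ?N +>\<^bsub>?F\<^esub> x"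
  note N = tensor_null_submodule[OF K V W]
  interpret F: module K ?F by (rule free_vs_module[OF K])
  interpret N: abelian_subgroup ?N ?F
    by (rule submodule_abelian_subgroup[OF F.module_axioms N])
  have \<phi>c: "\<phi> v w \<in> carrier U" if "v \<in> carrier V" "w \<in> carrier W" for v w
    using \<phi> that by (auto simp: bilinear_map_def module_hom_def)
  then obtain g where g: "g \<in> module_hom K ?F U"
    and ge: "\<And>v w. v \<in> carrier V \<Longrightarrow> w \<in> carrier W \<Longrightarrow> g (?e v w) = \<phi> v w"
    using free_vs_hom_exists[OF K U, of ?X "\<lambda>(v, w). \<phi> v w"] by fastforce
  interpret g: mod_hom K ?F U g by unfold_locales (rule g)
  have e: "?e v w \<in> carrier ?F" if "v \<in> carrier V" "w \<in> carrier W" for v w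
    using that by (auto intro: free_gen_carrier[OF K])
  have "tensor_rels K V W \<subseteq> g.ker"
  proof
    fix r assume r: "r \<in> tensor_rels K V W"
    then have "g r = \<zero>\<^bsub>U\<^esub>"
      unfolding tensor_rels_def Let_def
      using \<phi> by (auto simp: e ge \<phi>c bilinear_map_def module_hom_def a_minus_def U.M.r_neg)
    then show "r \<in> g.ker" using r tensor_rels_carrier[OF K V W] by (auto simp: g.ker_def)
  qed
  then have ker: "?N \<subseteq> g.ker"
    unfolding tensor_null_def by (intro F.span_is_subset g.ker_is_submodule)
  have const: "g y = g x" if x: "x \<in> carrier ?F" and y: "y \<in> ?p x" for x y
  proof -
    obtain n where n: "n \<in> ?N" "y = n \<oplus>\<^bsub>?F\<^esub> x" using y by (auto simp: a_r_coset_def')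
    then have "n \<in> carrier ?F" "g n = \<zero>\<^bsub>U\<^esub>" using ker by (auto simp: g.ker_def)
    then show ?thesis using n x by simp
  qed
  define h where "h C = g (SOME x. x \<in> C)" for C
  have h: "h (?p x) = g x" if x: "x \<in> carrier ?F" for x
  proof -
    have "(SOME y. y \<in> ?p x) \<in> ?p x" using N.a_rcos_self[OF x] by (rule someI[where P = "\<lambda>y. y \<in> ?p x"])
    then show ?thesis unfolding h_def by (rule const[OF x])
  qed
  have p: "?p \<in> module_hom K ?F (tensor K V W)"
    unfolding tensor_def by (rule quotient_vs_proj[OF F.module_axioms N])
  have car: "carrier (tensor K V W) = ?p ` carrier ?F"
    unfolding tensor_def by (rule quotient_vs_carrier[OF F.module_axioms N])
  have "h \<in> module_hom K (tensor K V W) U"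
    unfolding module_hom_def
    by (auto simp: car h module_hom_add[OF p, symmetric] module_hom_smult[OF p, symmetric])
  moreover have "h (tens K V W v w) = \<phi> v w" if "v \<in> carrier V" "w \<in> carrier W" for v w
    using that by (simp add: tens_def h e ge)
  ultimately show ?thesis by blast
qed

lemma tensor_lift_props:
  assumes K: "cring K" and V: "module K V" and W: "module K W" and U: "module K U"
    and \<phi>: "bilinear_map K V W U \<phi>"
  shows tensor_lift_hom: "tensor_lift K V W U \<phi> \<in> module_hom K (tensor K V W) U"
    and tensor_lift_tens: "v \<in> carrier V \<Longrightarrow> w \<in> carrier W \<Longrightarrow>
      tensor_lift K V W U \<phi> (tens K V W v w) = \<phi> v w"
proof -
  let ?T = "tensor K V W"
  let ?P = "\<lambda>h. h \<in> module_hom K ?T U \<and> h \<in> extensional (carrier ?T) \<and>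
            (\<forall>v\<in>carrier V. \<forall>w\<in>carrier W. h (tens K V W v w) = \<phi> v w)"
  interpret T: module K ?T by (rule tensor_module[OF K V W])
  have tc: "tens K V W v w \<in> carrier ?T" if "v \<in> carrier V" "w \<in> carrier W" for v w
    using tens_bilinear[OF K V W] that by (auto simp: bilinear_map_def module_hom_def)
  obtain h where h: "h \<in> module_hom K ?T U"
      "\<forall>v\<in>carrier V. \<forall>w\<in>carrier W. h (tens K V W v w) = \<phi> v w"
    using tensor_hom_exists[OF assms] by blast
  have "?P (restrict h (carrier ?T))"
    using h tc by (auto simp: module_hom_def Pi_def)
  moreover have "g = g'" if "?P g" "?P g'" for g g'
    by (rule extensionalityI[of _ "carrier ?T"])
      (use that in \<open>auto intro: tensor_hom_eqI[OF K V W U]\<close>)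
  ultimately have "\<exists>!h. ?P h" by blast
  then have P: "?P (tensor_lift K V W U \<phi>)" unfolding tensor_lift_def by (rule theI')
  show "tensor_lift K V W U \<phi> \<in> module_hom K ?T U" using P by blast
  show "tensor_lift K V W U \<phi> (tens K V W v w) = \<phi> v w" if "v \<in> carrier V" "w \<in> carrier W"
    using P that by blast
qed

definition tensor_map ::
  "('k, 'm) ring_scheme \<Rightarrow> ('k, 'v, 'm1) module_scheme \<Rightarrow> ('k, 'w, 'm2) module_scheme
    \<Rightarrow> ('k, 'v1, 'm3) module_scheme \<Rightarrow> ('k, 'w1, 'm4) module_scheme
    \<Rightarrow> ('v \<Rightarrow> 'v1) \<Rightarrow> ('w \<Rightarrow> 'w1) \<Rightarrow> ('v \<times> 'w \<Rightarrow> 'k) set \<Rightarrow> ('v1 \<times> 'w1 \<Rightarrow> 'k) set" where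
  "tensor_map K V W V' W' f g =
     tensor_lift K V W (tensor K V' W') (\<lambda>v w. tens K V' W' (f v) (g w))"

definition twist ::
  "('k, 'm) ring_scheme \<Rightarrow> ('k, 'v, 'm1) module_scheme
    \<Rightarrow> ('v \<times> 'v \<Rightarrow> 'k) set \<Rightarrow> ('v \<times> 'v \<Rightarrow> 'k) set" where
  "twist K V = tensor_lift K V V (tensor K V V) (\<lambda>x y. tens K V V y x)"

text \<open>
  \<open>tassoc\<close> and \<open>tassoc_inv\<close> are the mutually inverse canonical identifications of
  \<open>(V \<otimes> V) \<otimes> V\<close> and \<open>V \<otimes> (V \<otimes> V)\<close> with each other.
\<close>

definition tassoc ::
  "('k, 'm) ring_scheme \<Rightarrow> ('k, 'v, 'm1) module_scheme
    \<Rightarrow> (('v \<times> 'v \<Rightarrow> 'k) set \<times> 'v \<Rightarrow> 'k) set \<Rightarrow> ('v \<times> ('v \<times> 'v \<Rightarrow> 'k) set \<Rightarrow> 'k) set" where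
  "tassoc K V =
     tensor_lift K (tensor K V V) V (tensor K V (tensor K V V))
       (\<lambda>t z. tensor_lift K V V (tensor K V (tensor K V V))
                (\<lambda>x y. tens K V (tensor K V V) x (tens K V V y z)) t)"

definition tassoc_inv ::
  "('k, 'm) ring_scheme \<Rightarrow> ('k, 'v, 'm1) module_scheme
    \<Rightarrow> ('v \<times> ('v \<times> 'v \<Rightarrow> 'k) set \<Rightarrow> 'k) set \<Rightarrow> (('v \<times> 'v \<Rightarrow> 'k) set \<times> 'v \<Rightarrow> 'k) set" where
  "tassoc_inv K V =
     tensor_lift K V (tensor K V V) (tensor K (tensor K V V) V)
       (\<lambda>x t. tensor_lift K V V (tensor K (tensor K V V) V)
                (\<lambda>y z. tens K (tensor K V V) V (tens K V V x y) z) t)"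

locale eps_hom_bialgebra = vectorspace K A
  for K :: "('k, 'm) ring_scheme" and A :: "('k, 'a, 'm1) module_scheme" +
  fixes \<mu> :: "('a \<times> 'a \<Rightarrow> 'k) set \<Rightarrow> 'a"
    and \<Delta> :: "'a \<Rightarrow> ('a \<times> 'a \<Rightarrow> 'k) set"
    and \<alpha> :: "'a \<Rightarrow> 'a"
  assumes mult_hom: "\<mu> \<in> module_hom K (tensor K A A) A"
    and comult_hom: "\<Delta> \<in> module_hom K A (tensor K A A)"
    and alpha_hom: "\<alpha> \<in> module_hom K A A"
    and alpha_mult:
      "\<And>t. t \<in> carrier (tensor K A A) \<Longrightarrow> \<alpha> (\<mu> t) = \<mu> (tensor_map K A A A A \<alpha> \<alpha> t)"
    and hom_assoc:
      "\<And>t. t \<in> carrier (tensor K (tensor K A A) A) \<Longrightarrow>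
         \<mu> (tensor_map K A (tensor K A A) A A \<alpha> \<mu> (tassoc K A t))
       = \<mu> (tensor_map K (tensor K A A) A A A \<mu> \<alpha> t)"
    and alpha_comult:
      "\<And>x. x \<in> carrier A \<Longrightarrow> tensor_map K A A A A \<alpha> \<alpha> (\<Delta> x) = \<Delta> (\<alpha> x)"
    and hom_coassoc:
      "\<And>x. x \<in> carrier A \<Longrightarrow>
         tensor_map K A A A (tensor K A A) \<alpha> \<Delta> (\<Delta> x)
       = tassoc K A (tensor_map K A A (tensor K A A) A \<Delta> \<alpha> (\<Delta> x))"
    and comult_mult:
      "\<And>t. t \<in> carrier (tensor K A A) \<Longrightarrow>
         \<Delta> (\<mu> t)
       = tensor_map K (tensor K A A) A A A \<mu> \<alpha>
           (tassoc_inv K A (tensor_map K A A A (tensor K A A) \<alpha> \<Delta> t))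
         \<oplus>\<^bsub>tensor K A A\<^esub>
         tensor_map K A (tensor K A A) A A \<alpha> \<mu>
           (tassoc K A (tensor_map K A A (tensor K A A) A \<Delta> \<alpha> t))"

definition bullet ::
  "('k, 'm) ring_scheme \<Rightarrow> ('k, 'a, 'm1) module_scheme
    \<Rightarrow> (('a \<times> 'a \<Rightarrow> 'k) set \<Rightarrow> 'a) \<Rightarrow> ('a \<Rightarrow> 'a)
    \<Rightarrow> 'a \<Rightarrow> ('a \<times> 'a \<Rightarrow> 'k) set \<Rightarrow> ('a \<times> 'a \<Rightarrow> 'k) set" where
  "bullet K A \<mu> \<alpha> a b =
     tensor_map K A A A A (\<lambda>x. \<mu> (tens K A A (\<alpha> a) x)) \<alpha> b
     \<ominus>\<^bsub>tensor K A A\<^esub>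
     tensor_map K A A A A \<alpha> (\<lambda>x. \<mu> (tens K A A x (\<alpha> a))) b"

definition comult_op ::
  "('k, 'm) ring_scheme \<Rightarrow> ('k, 'a, 'm1) module_scheme
    \<Rightarrow> ('a \<Rightarrow> ('a \<times> 'a \<Rightarrow> 'k) set) \<Rightarrow> 'a \<Rightarrow> ('a \<times> 'a \<Rightarrow> 'k) set" where
  "comult_op K A \<Delta> = twist K A \<circ> \<Delta>"

definition balanceator ::
  "('k, 'm) ring_scheme \<Rightarrow> ('k, 'a, 'm1) module_scheme
    \<Rightarrow> (('a \<times> 'a \<Rightarrow> 'k) set \<Rightarrow> 'a) \<Rightarrow> ('a \<Rightarrow> ('a \<times> 'a \<Rightarrow> 'k) set) \<Rightarrow> ('a \<Rightarrow> 'a)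
    \<Rightarrow> ('a \<times> 'a \<Rightarrow> 'k) set \<Rightarrow> ('a \<times> 'a \<Rightarrow> 'k) set" where
  "balanceator K A \<mu> \<Delta> \<alpha> =
     tensor_lift K A A (tensor K A A)
       (\<lambda>x y. bullet K A \<mu> \<alpha> x (comult_op K A \<Delta> y)
              \<oplus>\<^bsub>tensor K A A\<^esub> twist K A (bullet K A \<mu> \<alpha> y (comult_op K A \<Delta> x)))"

definition symmetric_map ::
  "('k, 'm) ring_scheme \<Rightarrow> ('k, 'a, 'm1) module_scheme
    \<Rightarrow> (('a \<times> 'a \<Rightarrow> 'k) set \<Rightarrow> ('a \<times> 'a \<Rightarrow> 'k) set) \<Rightarrow> bool" where
  "symmetric_map K A B \<longleftrightarrow>
     (\<forall>x\<in>carrier A. \<forall>y\<in>carrier A. B (tens K A A x y) = B (tens K A A y x))"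

definition derived_mult :: "('a \<Rightarrow> 'a) \<Rightarrow> ('t \<Rightarrow> 'a) \<Rightarrow> nat \<Rightarrow> 't \<Rightarrow> 'a" where
  "derived_mult \<alpha> \<mu> n = (\<alpha> ^^ (2 ^ n - 1)) \<circ> \<mu>"

definition derived_comult :: "('a \<Rightarrow> 'a) \<Rightarrow> ('a \<Rightarrow> 't) \<Rightarrow> nat \<Rightarrow> 'a \<Rightarrow> 't" where
  "derived_comult \<alpha> \<Delta> n = \<Delta> \<circ> (\<alpha> ^^ (2 ^ n - 1))"

definition derived_alpha :: "('a \<Rightarrow> 'a) \<Rightarrow> nat \<Rightarrow> 'a \<Rightarrow> 'a" where
  "derived_alpha \<alpha> n = \<alpha> ^^ (2 ^ n)"

definition derived_balanceator ::
  "('k, 'm) ring_scheme \<Rightarrow> ('k, 'a, 'm1) module_scheme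
    \<Rightarrow> (('a \<times> 'a \<Rightarrow> 'k) set \<Rightarrow> 'a) \<Rightarrow> ('a \<Rightarrow> ('a \<times> 'a \<Rightarrow> 'k) set) \<Rightarrow> ('a \<Rightarrow> 'a) \<Rightarrow> nat
    \<Rightarrow> ('a \<times> 'a \<Rightarrow> 'k) set \<Rightarrow> ('a \<times> 'a \<Rightarrow> 'k) set" where
  "derived_balanceator K A \<mu> \<Delta> \<alpha> n =
     balanceator K A (derived_mult \<alpha> \<mu> n) (derived_comult \<alpha> \<Delta> n) (derived_alpha \<alpha> n)"

end

theory Submission
  imports Defs
begin

text \<open>
  Let \<open>\<beta>\<close> be a linear map that commutes with \<open>\<mu>\<close>, \<open>\<Delta>\<close> and \<open>\<alpha>\<close>. In each term of the balanceator
  formed with \<open>\<beta>\<mu>\<close>, \<open>\<Delta>\<beta>\<close> and \<open>\<alpha>\<beta>\<close>, each of the two tensor factors carries exactly two copies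
  of \<open>\<beta>\<close>, so this balanceator is the original one followed by \<open>\<beta>\<^sup>2 \<otimes> \<beta>\<^sup>2\<close>. The derived bialgebra is
  the case \<open>\<beta> = \<alpha>\<^bsup>k\<^esup>\<close>, \<open>k = 2\<^bsup>n\<^esup> - 1\<close>. Injectivity of \<open>\<alpha> \<otimes> \<alpha>\<close> passes to its powers, which gives
  the converse.
\<close>

section \<open>Closure properties of linear and bilinear maps\<close>

lemma module_hom_in_carrier:
  "f \<in> module_hom K V W \<Longrightarrow> v \<in> carrier V \<Longrightarrow> f v \<in> carrier W"
  by (auto simp: module_hom_def)

lemma module_hom_id: "(\<lambda>x. x) \<in> module_hom K V V"
  by (simp add: module_hom_def)

lemma module_hom_comp:
  "f \<in> module_hom K U V \<Longrightarrow> g \<in> module_hom K V W \<Longrightarrow> (\<lambda>x. g (f x)) \<in> module_hom K U W"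
  by (auto simp: module_hom_def Pi_def)

text \<open>The module structure of \<open>V\<close> keeps sums and scalar multiples inside the
  carrier, where \<open>g\<close> is known to agree with \<open>f\<close>; so linearity carries
  over.\<close>

lemma module_hom_cong:
  assumes "module K V" "f \<in> module_hom K V W" "\<And>v. v \<in> carrier V \<Longrightarrow> g v = f v"
  shows "g \<in> module_hom K V W"
proof -
  interpret module K V by (rule assms(1))
  show ?thesis using assms(2,3) by (auto simp: module_hom_def)
qed

lemma module_hom_sum:
  assumes W: "module K W" and f: "f \<in> module_hom K V W" and g: "g \<in> module_hom K V W"
  shows "(\<lambda>x. f x \<oplus>\<^bsub>W\<^esub> g x) \<in> module_hom K V W"
proof -
  interpret module K W by (rule W)
  show ?thesis using f g by (auto simp: module_hom_def smult_r_distr Pi_def M.a_ac)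
qed

lemma module_hom_diff:
  assumes W: "module K W" and f: "f \<in> module_hom K V W" and g: "g \<in> module_hom K V W"
  shows "(\<lambda>x. f x \<ominus>\<^bsub>W\<^esub> g x) \<in> module_hom K V W"
proof -
  interpret module K W by (rule W)
  have "(\<lambda>x. \<ominus>\<^bsub>W\<^esub> g x) \<in> module_hom K V W"
    using g by (auto simp: module_hom_def smult_r_minus Pi_def M.minus_add M.a_comm)
  from module_hom_sum[OF W f this] show ?thesis by (simp add: a_minus_def)
qed

lemma bilinear_map_cong:
  assumes "module K V" "module K W" "bilinear_map K V W U \<phi>"
    "\<And>v w. v \<in> carrier V \<Longrightarrow> w \<in> carrier W \<Longrightarrow> \<psi> v w = \<phi> v w"
  shows "bilinear_map K V W U \<psi>"
  using assms unfolding bilinear_map_def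
  by (auto intro: module_hom_cong[OF assms(1)] module_hom_cong[OF assms(2)])

lemma bilinear_map_closed:
  "bilinear_map K V W U \<phi> \<Longrightarrow> v \<in> carrier V \<Longrightarrow> w \<in> carrier W \<Longrightarrow> \<phi> v w \<in> carrier U"
  by (auto simp: bilinear_map_def intro: module_hom_in_carrier)

text \<open>The main tool for building bilinear maps below: a slot that stays unchanged is filled
  with \<open>module_hom_id\<close>.\<close>

lemma bilinear_map_comp:
  assumes "bilinear_map K V W U \<phi>"
    and "f \<in> module_hom K V' V" "g \<in> module_hom K W' W" "h \<in> module_hom K U U'"
  shows "bilinear_map K V' W' U' (\<lambda>v w. h (\<phi> (f v) (g w)))"
  unfolding bilinear_map_def
proof (intro conjI ballI)
  fix w assume "w \<in> carrier W'"
  then have "(\<lambda>v. \<phi> v (g w)) \<in> module_hom K V U"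
    using assms by (auto simp: bilinear_map_def module_hom_in_carrier)
  from module_hom_comp[OF module_hom_comp[OF assms(2) this] assms(4)]
  show "(\<lambda>v. h (\<phi> (f v) (g w))) \<in> module_hom K V' U'" .
next
  fix v assume "v \<in> carrier V'"
  then have "\<phi> (f v) \<in> module_hom K W U"
    using assms by (auto simp: bilinear_map_def module_hom_in_carrier)
  from module_hom_comp[OF module_hom_comp[OF assms(3) this] assms(4)]
  show "(\<lambda>w. h (\<phi> (f v) (g w))) \<in> module_hom K W' U'" .
qed

lemma bilinear_map_flip:
  "bilinear_map K V W U \<phi> \<Longrightarrow> bilinear_map K W V U (\<lambda>w v. \<phi> v w)"
  by (auto simp: bilinear_map_def)

lemma bilinear_map_sum:
  "module K U \<Longrightarrow> bilinear_map K V W U \<phi> \<Longrightarrow> bilinear_map K V W U \<psi> \<Longrightarrow>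
    bilinear_map K V W U (\<lambda>v w. \<phi> v w \<oplus>\<^bsub>U\<^esub> \<psi> v w)"
  by (auto simp: bilinear_map_def intro!: module_hom_sum)

lemma bilinear_map_diff:
  "module K U \<Longrightarrow> bilinear_map K V W U \<phi> \<Longrightarrow> bilinear_map K V W U \<psi> \<Longrightarrow>
    bilinear_map K V W U (\<lambda>v w. \<phi> v w \<ominus>\<^bsub>U\<^esub> \<psi> v w)"
  by (auto simp: bilinear_map_def intro!: module_hom_diff)

section \<open>Functoriality of the tensor product\<close>

lemma tens_closed:
  "cring K \<Longrightarrow> module K V \<Longrightarrow> module K W \<Longrightarrow> v \<in> carrier V \<Longrightarrow> w \<in> carrier W \<Longrightarrow>
    tens K V W v w \<in> carrier (tensor K V W)"
  by (rule bilinear_map_closed[OF tens_bilinear])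

text \<open>Both sides are linear in \<open>t\<close> and agree on pure tensors. Bilinearity of
  \<open>\<psi>\<close> is inherited from \<open>h\<close> after \<open>\<phi>\<close>, so a twisted
  balanceator can be compared with the original one without a separate bilinearity proof.\<close>

lemma tensor_lift_comp:
  assumes K: "cring K" and V: "module K V" and W: "module K W"
    and U: "module K U" and U': "module K U'"
    and \<phi>: "bilinear_map K V W U \<phi>" and h: "h \<in> module_hom K U U'"
    and eq: "\<And>v w. v \<in> carrier V \<Longrightarrow> w \<in> carrier W \<Longrightarrow> \<psi> v w = h (\<phi> v w)"
    and t: "t \<in> carrier (tensor K V W)"
  shows "tensor_lift K V W U' \<psi> t = h (tensor_lift K V W U \<phi> t)"
proof -
  have \<psi>: "bilinear_map K V W U' \<psi>"
    by (rule bilinear_map_cong[OF V W bilinear_map_comp[OF \<phi> module_hom_id module_hom_id h]])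
      (rule eq)
  show ?thesis
    by (rule tensor_hom_eqI[OF K V W U' tensor_lift_hom[OF K V W U' \<psi>]
          module_hom_comp[OF tensor_lift_hom[OF K V W U \<phi>] h] _ t])
      (simp add: tensor_lift_tens[OF K V W U' \<psi>] tensor_lift_tens[OF K V W U \<phi>] eq)
qed

lemma tensor_map_props:
  assumes K: "cring K" and V: "module K V" and W: "module K W"
    and V': "module K V'" and W': "module K W'"
    and f: "f \<in> module_hom K V V'" and g: "g \<in> module_hom K W W'"
  shows tensor_map_hom:
      "tensor_map K V W V' W' f g \<in> module_hom K (tensor K V W) (tensor K V' W')"
    and tensor_map_tens: "v \<in> carrier V \<Longrightarrow> w \<in> carrier W \<Longrightarrow>
      tensor_map K V W V' W' f g (tens K V W v w) = tens K V' W' (f v) (g w)"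
  using tensor_lift_props[OF K V W tensor_module[OF K V' W']
      bilinear_map_comp[OF tens_bilinear[OF K V' W'] f g module_hom_id]]
  by (auto simp: tensor_map_def)

text \<open>Two commuting squares tensor to a commuting square, because both composites are linear
  and agree on pure tensors. In this form \<open>\<beta>\<close> is later moved past the structure
  maps.\<close>

lemma tensor_map_square:
  assumes K: "cring K" and M: "module K V" "module K W" "module K V1" "module K W1"
      "module K V2" "module K W2" "module K V3" "module K W3"
    and f: "f \<in> module_hom K V V1" "g \<in> module_hom K W W1"
      "f' \<in> module_hom K V1 V3" "g' \<in> module_hom K W1 W3"
    and p: "p \<in> module_hom K V V2" "q \<in> module_hom K W W2"
      "p' \<in> module_hom K V2 V3" "q' \<in> module_hom K W2 W3"
    and eq: "\<And>v. v \<in> carrier V \<Longrightarrow> f' (f v) = p' (p v)"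
      "\<And>w. w \<in> carrier W \<Longrightarrow> g' (g w) = q' (q w)"
    and t: "t \<in> carrier (tensor K V W)"
  shows "tensor_map K V1 W1 V3 W3 f' g' (tensor_map K V W V1 W1 f g t) =
    tensor_map K V2 W2 V3 W3 p' q' (tensor_map K V W V2 W2 p q t)"
proof (rule tensor_hom_eqI[OF K M(1,2) tensor_module[OF K M(7,8)] _ _ _ t])
  show "(\<lambda>t. tensor_map K V1 W1 V3 W3 f' g' (tensor_map K V W V1 W1 f g t))
      \<in> module_hom K (tensor K V W) (tensor K V3 W3)"
    by (rule module_hom_comp[OF tensor_map_hom[OF K M(1-4) f(1,2)]
          tensor_map_hom[OF K M(3,4,7,8) f(3,4)]])
  show "(\<lambda>t. tensor_map K V2 W2 V3 W3 p' q' (tensor_map K V W V2 W2 p q t))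
      \<in> module_hom K (tensor K V W) (tensor K V3 W3)"
    by (rule module_hom_comp[OF tensor_map_hom[OF K M(1,2,5,6) p(1,2)]
          tensor_map_hom[OF K M(5-8) p(3,4)]])
qed (simp add: tensor_map_tens K M f p eq module_hom_in_carrier[OF f(1)]
    module_hom_in_carrier[OF f(2)] module_hom_in_carrier[OF p(1)] module_hom_in_carrier[OF p(2)])

lemma tensor_map_comp:
  assumes K: "cring K" and M: "module K V" "module K W" "module K V1" "module K W1"
      "module K V2" "module K W2"
    and f: "f \<in> module_hom K V V1" "g \<in> module_hom K W W1"
      "f' \<in> module_hom K V1 V2" "g' \<in> module_hom K W1 W2"
    and t: "t \<in> carrier (tensor K V W)"
  shows "tensor_map K V W V2 W2 (\<lambda>v. f' (f v)) (\<lambda>w. g' (g w)) t =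
    tensor_map K V1 W1 V2 W2 f' g' (tensor_map K V W V1 W1 f g t)"
proof (rule tensor_hom_eqI[OF K M(1,2) tensor_module[OF K M(5,6)] _ _ _ t])
  note f2 = module_hom_comp[OF f(1,3)] module_hom_comp[OF f(2,4)]
  show "tensor_map K V W V2 W2 (\<lambda>v. f' (f v)) (\<lambda>w. g' (g w))
      \<in> module_hom K (tensor K V W) (tensor K V2 W2)"
    by (rule tensor_map_hom[OF K M(1,2,5,6) f2])
  show "(\<lambda>t. tensor_map K V1 W1 V2 W2 f' g' (tensor_map K V W V1 W1 f g t))
      \<in> module_hom K (tensor K V W) (tensor K V2 W2)"
    by (rule module_hom_comp[OF tensor_map_hom[OF K M(1-4) f(1,2)]
          tensor_map_hom[OF K M(3-6) f(3,4)]])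
  fix v w assume "v \<in> carrier V" "w \<in> carrier W"
  then show "tensor_map K V W V2 W2 (\<lambda>v. f' (f v)) (\<lambda>w. g' (g w)) (tens K V W v w) =
      tensor_map K V1 W1 V2 W2 f' g' (tensor_map K V W V1 W1 f g (tens K V W v w))"
    by (simp add: tensor_map_tens[OF K M(1,2,5,6) f2] tensor_map_tens K M f
        module_hom_in_carrier[OF f(1)] module_hom_in_carrier[OF f(2)])
qed

lemma tensor_map_id:
  assumes K: "cring K" and V: "module K V" and W: "module K W"
    and t: "t \<in> carrier (tensor K V W)"
  shows "tensor_map K V W V W (\<lambda>v. v) (\<lambda>w. w) t = t"
  by (rule tensor_hom_eqI[OF K V W tensor_module[OF K V W] tensor_map_hom module_hom_id _ t])
    (simp_all add: K V W module_hom_id tensor_map_tens)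

text \<open>Linearity in \<open>t\<close> is \<open>tensor_map_hom\<close>. For linearity in
  \<open>a\<close>, each law is an equation between linear maps of \<open>t\<close>, so it suffices
  to check it on pure tensors, where it follows from bilinearity of \<open>tens\<close>.\<close>

lemma tensor_map_bilinear_left:
  assumes K: "cring K" and M: "module K A" "module K V" "module K W" "module K V'" "module K W'"
    and \<phi>: "bilinear_map K A V V' \<phi>" and g: "g \<in> module_hom K W W'"
  shows "bilinear_map K A (tensor K V W) (tensor K V' W')
    (\<lambda>a. tensor_map K V W V' W' (\<phi> a) g)"
proof -
  interpret A: module K A by (rule M)
  note tb = tens_bilinear[OF K M(4,5)]
  note T = tensor_module[OF K M(4,5)]
  interpret T: module K "tensor K V' W'" by (rule T)
  have \<phi>h: "\<phi> a \<in> module_hom K V V'" if "a \<in> carrier A" for a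
    using \<phi> that by (auto simp: bilinear_map_def)
  have m: "tensor_map K V W V' W' (\<phi> a) g \<in> module_hom K (tensor K V W) (tensor K V' W')"
    if "a \<in> carrier A" for a
    by (intro tensor_map_hom K M g \<phi>h that)
  have b: "bilinear_map K A W (tensor K V' W') (\<lambda>a w. tens K V' W' (\<phi> a v) (g w))"
    if "v \<in> carrier V" for v
    using bilinear_map_comp[OF tb _ g module_hom_id, of "\<lambda>a. \<phi> a v" A] \<phi> that
    by (auto simp: bilinear_map_def)
  have lin: "(\<lambda>a. tens K V' W' (\<phi> a v) (g w)) \<in> module_hom K A (tensor K V' W')"
    if "v \<in> carrier V" "w \<in> carrier W" for v w
    using b that by (auto simp: bilinear_map_def)
  \<comment> \<open>A scalar multiple of a linear map is again linear because \<open>K\<close> is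
    commutative. This makes the right-hand side of the homogeneity law admissible for
    \<open>eqI\<close>.\<close>
  have scale: "(\<lambda>t. c \<odot>\<^bsub>tensor K V' W'\<^esub> h t) \<in> module_hom K (tensor K V W) (tensor K V' W')"
    if h: "h \<in> module_hom K (tensor K V W) (tensor K V' W')" and c: "c \<in> carrier K" for h c
    using h c
    by (auto simp: module_hom_def Pi_def T.smult_r_distr T.smult_assoc1[symmetric]
        cring.cring_simprules(14)[OF K])
  note eqI = tensor_hom_eqI[OF K M(2,3) T]
  have "(\<lambda>a. tensor_map K V W V' W' (\<phi> a) g t) \<in> module_hom K A (tensor K V' W')"
    if t: "t \<in> carrier (tensor K V W)" for t
    unfolding module_hom_def
  proof (intro CollectI conjI allI impI funcsetI)
    fix a assume "a \<in> carrier A"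
    then show "tensor_map K V W V' W' (\<phi> a) g t \<in> carrier (tensor K V' W')"
      using m t by (blast intro: module_hom_in_carrier)
  next
    fix a b assume "a \<in> carrier A \<and> b \<in> carrier A"
    then have ab: "a \<in> carrier A" "b \<in> carrier A" "a \<oplus>\<^bsub>A\<^esub> b \<in> carrier A" by auto
    show "tensor_map K V W V' W' (\<phi> (a \<oplus>\<^bsub>A\<^esub> b)) g t =
        tensor_map K V W V' W' (\<phi> a) g t \<oplus>\<^bsub>tensor K V' W'\<^esub> tensor_map K V W V' W' (\<phi> b) g t"
      by (rule eqI[OF m[OF ab(3)] module_hom_sum[OF T m[OF ab(1)] m[OF ab(2)]] _ t])
        (simp add: tensor_map_tens K M g \<phi>h ab module_hom_add[OF lin])
  next
    fix c a assume "c \<in> carrier K \<and> a \<in> carrier A"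
    then have ca: "c \<in> carrier K" "a \<in> carrier A" "c \<odot>\<^bsub>A\<^esub> a \<in> carrier A" by auto
    show "tensor_map K V W V' W' (\<phi> (c \<odot>\<^bsub>A\<^esub> a)) g t =
        c \<odot>\<^bsub>tensor K V' W'\<^esub> tensor_map K V W V' W' (\<phi> a) g t"
      by (rule eqI[OF m[OF ca(3)] scale[OF m[OF ca(2)] ca(1)] _ t])
        (simp add: tensor_map_tens K M g \<phi>h ca module_hom_smult[OF lin])
  qed
  with m show ?thesis by (simp add: bilinear_map_def)
qed

section \<open>The twist and its naturality\<close>

lemma twist_props:
  assumes K: "cring K" and V: "module K V"
  shows twist_hom: "twist K V \<in> module_hom K (tensor K V V) (tensor K V V)"
    and twist_tens: "x \<in> carrier V \<Longrightarrow> y \<in> carrier V \<Longrightarrow>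
      twist K V (tens K V V x y) = tens K V V y x"
  using tensor_lift_props[OF K V V tensor_module[OF K V V]
      bilinear_map_flip[OF tens_bilinear[OF K V V]]]
  by (auto simp: twist_def)

lemma twist_tensor_map:
  assumes K: "cring K" and M: "module K V" "module K V'"
    and f: "f \<in> module_hom K V V'" and g: "g \<in> module_hom K V V'"
    and t: "t \<in> carrier (tensor K V V)"
  shows "twist K V' (tensor_map K V V V' V' f g t) = tensor_map K V V V' V' g f (twist K V t)"
  by (rule tensor_hom_eqI[OF K M(1,1) tensor_module[OF K M(2,2)]
        module_hom_comp[OF tensor_map_hom[OF K M(1,1,2,2) f g] twist_hom[OF K M(2)]]
        module_hom_comp[OF twist_hom[OF K M(1)] tensor_map_hom[OF K M(1,1,2,2) g f]] _ t])
    (simp add: tensor_map_tens twist_tens K M f g module_hom_in_carrier[OF f]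
      module_hom_in_carrier[OF g])

lemma twist_twist:
  assumes K: "cring K" and V: "module K V" and t: "t \<in> carrier (tensor K V V)"
  shows "twist K V (twist K V t) = t"
  by (rule tensor_hom_eqI[OF K V V tensor_module[OF K V V] module_hom_comp[OF twist_hom twist_hom]
        module_hom_id _ t]) (simp_all add: K V twist_tens)

text \<open>Conjugating with the twist exchanges the two factors and reduces the claim to
  \<open>tensor_map_bilinear_left\<close>.\<close>

lemma tensor_map_bilinear_right:
  assumes K: "cring K" and M: "module K A" "module K V" "module K V'"
    and \<phi>: "bilinear_map K A V V' \<phi>" and g: "g \<in> module_hom K V V'"
  shows "bilinear_map K A (tensor K V V) (tensor K V' V')
    (\<lambda>a. tensor_map K V V V' V' g (\<phi> a))"
proof (rule bilinear_map_cong[OF M(1) tensor_module[OF K M(2,2)]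
      bilinear_map_comp[OF tensor_map_bilinear_left[OF K M(1,2,2,3,3) \<phi> g]
        module_hom_id twist_hom[OF K M(2)] twist_hom[OF K M(3)]]])
  fix a t assume a: "a \<in> carrier A" and t: "t \<in> carrier (tensor K V V)"
  have \<phi>a: "\<phi> a \<in> module_hom K V V'" using \<phi> a by (simp add: bilinear_map_def)
  show "tensor_map K V V V' V' g (\<phi> a) t =
      twist K V' (tensor_map K V V V' V' (\<phi> a) g (twist K V t))"
    using module_hom_in_carrier[OF twist_hom[OF K M(2)] t]
    by (simp add: twist_tensor_map[OF K M(2,3) \<phi>a g] twist_twist[OF K M(2) t])
qed

section \<open>Bilinearity of the bracket and of the balanceator\<close>

lemma bullet_bilinear:
  assumes K: "cring K" and A: "module K A"
    and \<mu>: "\<mu> \<in> module_hom K (tensor K A A) A" and \<alpha>: "\<alpha> \<in> module_hom K A A"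
  shows "bilinear_map K A (tensor K A A) (tensor K A A) (bullet K A \<mu> \<alpha>)"
proof -
  note tb = tens_bilinear[OF K A A]
  have "bilinear_map K A A A (\<lambda>a x. \<mu> (tens K A A (\<alpha> a) x))"
    by (rule bilinear_map_comp[OF tb \<alpha> module_hom_id \<mu>])
  moreover have "bilinear_map K A A A (\<lambda>a x. \<mu> (tens K A A x (\<alpha> a)))"
    by (rule bilinear_map_comp[OF bilinear_map_flip[OF tb] \<alpha> module_hom_id \<mu>])
  ultimately show ?thesis
    unfolding bullet_def[abs_def]
    by (intro bilinear_map_diff tensor_module K A tensor_map_bilinear_left
        tensor_map_bilinear_right \<alpha>)
qed

lemma comult_op_hom:
  assumes "cring K" "module K A" "\<Delta> \<in> module_hom K A (tensor K A A)"
  shows "comult_op K A \<Delta> \<in> module_hom K A (tensor K A A)"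
  using module_hom_comp[OF assms(3) twist_hom[OF assms(1,2)]] by (simp add: comult_op_def comp_def)

text \<open>\<open>balanceator\<close> is a \<open>tensor_lift\<close>, hence a definite
  description, and bilinearity of the underlying form is what gives it its meaning.\<close>

lemma balanceator_form_bilinear:
  assumes K: "cring K" and A: "module K A"
    and \<mu>: "\<mu> \<in> module_hom K (tensor K A A) A" and \<Delta>: "\<Delta> \<in> module_hom K A (tensor K A A)"
    and \<alpha>: "\<alpha> \<in> module_hom K A A"
  shows "bilinear_map K A A (tensor K A A)
    (\<lambda>x y. bullet K A \<mu> \<alpha> x (comult_op K A \<Delta> y)
       \<oplus>\<^bsub>tensor K A A\<^esub> twist K A (bullet K A \<mu> \<alpha> y (comult_op K A \<Delta> x)))"
proof -
  note b = bullet_bilinear[OF K A \<mu> \<alpha>] and op = comult_op_hom[OF K A \<Delta>]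
  \<comment> \<open>In the second summand \<open>x\<close> enters through the opposite
    comultiplication and \<open>y\<close> directly, hence the flipped bracket followed by the
    twist.\<close>
  show ?thesis
    by (intro bilinear_map_sum tensor_module K A
        bilinear_map_comp[OF b module_hom_id op module_hom_id]
        bilinear_map_comp[OF bilinear_map_flip[OF b] op module_hom_id twist_hom[OF K A]])
qed

section \<open>Twisting the structure maps by a commuting endomorphism\<close>

context
  fixes K :: "('k, 'm) ring_scheme" and A :: "('k, 'a, 'm1) module_scheme"
    and \<mu> \<Delta> \<alpha> \<beta>
  assumes K: "cring K" and A: "module K A"
    and \<mu>: "\<mu> \<in> module_hom K (tensor K A A) A" and \<Delta>: "\<Delta> \<in> module_hom K A (tensor K A A)"
    and \<alpha>: "\<alpha> \<in> module_hom K A A" and \<beta>: "\<beta> \<in> module_hom K A A"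
    and \<beta>_mult: "\<And>x y. x \<in> carrier A \<Longrightarrow> y \<in> carrier A \<Longrightarrow>
      \<beta> (\<mu> (tens K A A x y)) = \<mu> (tens K A A (\<beta> x) (\<beta> y))"
    and \<beta>_comult: "\<And>x. x \<in> carrier A \<Longrightarrow> tensor_map K A A A A \<beta> \<beta> (\<Delta> x) = \<Delta> (\<beta> x)"
    and \<beta>_comm: "\<And>x. x \<in> carrier A \<Longrightarrow> \<alpha> (\<beta> x) = \<beta> (\<alpha> x)"
begin

text \<open>\<open>\<beta>_comult\<close> puts one \<open>\<beta>\<close> on each factor, and the
  twist leaves \<beta> \<otimes> \<beta> unchanged.\<close>

lemma comult_op_twisted:
  assumes x: "x \<in> carrier A"
  shows "comult_op K A (\<Delta> \<circ> \<beta>) x = tensor_map K A A A A \<beta> \<beta> (comult_op K A \<Delta> x)"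
  using twist_tensor_map[OF K A A \<beta> \<beta> module_hom_in_carrier[OF \<Delta> x]]
  by (simp add: comult_op_def \<beta>_comult[OF x])

text \<open>The second argument already carries \<beta> \<otimes> \<beta>, as supplied by
  \<open>comult_op_twisted\<close>; the twisted structure maps contribute the second copy of
  \<open>\<beta>\<close> on each factor.\<close>

lemma bullet_twisted:
  assumes a: "a \<in> carrier A" and t: "t \<in> carrier (tensor K A A)"
  shows "bullet K A (\<beta> \<circ> \<mu>) (\<alpha> \<circ> \<beta>) a (tensor_map K A A A A \<beta> \<beta> t) =
    tensor_map K A A A A (\<beta> \<circ> \<beta>) (\<beta> \<circ> \<beta>) (bullet K A \<mu> \<alpha> a t)"
proof -
  note c = module_hom_in_carrier[OF \<alpha>] module_hom_in_carrier[OF \<beta>]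
  interpret T: module K "tensor K A A" by (rule tensor_module[OF K A A])
  have \<alpha>\<beta>: "\<alpha> \<circ> \<beta> \<in> module_hom K A A" and \<beta>\<beta>: "\<beta> \<circ> \<beta> \<in> module_hom K A A"
    using module_hom_comp[OF \<beta> \<alpha>] module_hom_comp[OF \<beta> \<beta>] by (simp_all add: comp_def)
  have \<beta>\<mu>: "\<beta> \<circ> \<mu> \<in> module_hom K (tensor K A A) A"
    using module_hom_comp[OF \<mu> \<beta>] by (simp add: comp_def)
  note tb = tens_bilinear[OF K A A]
  \<comment> \<open>The product \<open>\<nu>\<close> stays general because both \<open>\<mu>\<close>
    and \<open>\<beta> \<circ> \<mu>\<close> are inserted for it.\<close>
  have L: "(\<lambda>x. \<nu> (tens K A A b x)) \<in> module_hom K A A"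
    and R: "(\<lambda>x. \<nu> (tens K A A x b)) \<in> module_hom K A A"
    if "\<nu> \<in> module_hom K (tensor K A A) A" "b \<in> carrier A" for \<nu> b
    using tb that by (auto simp: bilinear_map_def intro: module_hom_comp)
  let ?\<gamma> = "tensor_map K A A A A (\<beta> \<circ> \<beta>) (\<beta> \<circ> \<beta>)"
  let ?l = "tensor_map K A A A A (\<lambda>x. \<mu> (tens K A A (\<alpha> a) x)) \<alpha> t"
  let ?r = "tensor_map K A A A A \<alpha> (\<lambda>x. \<mu> (tens K A A x (\<alpha> a))) t"
  have h: "?\<gamma> \<in> module_hom K (tensor K A A) (tensor K A A)"
    by (intro tensor_map_hom K A \<beta>\<beta>)
  have l: "?l \<in> carrier (tensor K A A)" and r: "?r \<in> carrier (tensor K A A)"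
    by (intro module_hom_in_carrier[OF tensor_map_hom t] K A \<alpha> L R \<mu> c a)+
  \<comment> \<open>On the first factor, \<beta>(\<mu>(\<alpha>\<beta>a, \<beta>x)) =
    \<beta>\<beta>\<mu>(\<alpha>a, x) by \<open>\<beta>_comm\<close> and
    \<open>\<beta>_mult\<close>; on the second, \<alpha>\<beta>\<beta> = \<beta>\<beta>\<alpha>. The
    other half of the bracket is the mirror image.\<close>
  have "tensor_map K A A A A (\<lambda>x. (\<beta> \<circ> \<mu>) (tens K A A ((\<alpha> \<circ> \<beta>) a) x)) (\<alpha> \<circ> \<beta>)
      (tensor_map K A A A A \<beta> \<beta> t) = ?\<gamma> ?l"
    by (rule tensor_map_square[OF K A A A A A A A A \<beta> \<beta> L[OF \<beta>\<mu>] \<alpha>\<beta> L[OF \<mu>] \<alpha> \<beta>\<beta> \<beta>\<beta> _ _ t])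
      (simp_all add: a c \<beta>_mult \<beta>_comm)
  moreover have "tensor_map K A A A A (\<alpha> \<circ> \<beta>) (\<lambda>x. (\<beta> \<circ> \<mu>) (tens K A A x ((\<alpha> \<circ> \<beta>) a)))
      (tensor_map K A A A A \<beta> \<beta> t) = ?\<gamma> ?r"
    by (rule tensor_map_square[OF K A A A A A A A A \<beta> \<beta> \<alpha>\<beta> R[OF \<beta>\<mu>] \<alpha> R[OF \<mu>] \<beta>\<beta> \<beta>\<beta> _ _ t])
      (simp_all add: a c \<beta>_mult \<beta>_comm)
  moreover have "?\<gamma> (?l \<ominus>\<^bsub>tensor K A A\<^esub> ?r) = ?\<gamma> ?l \<ominus>\<^bsub>tensor K A A\<^esub> ?\<gamma> ?r"
  proof -
    interpret \<gamma>: mod_hom K "tensor K A A" "tensor K A A" ?\<gamma> by unfold_locales (rule h)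
    show ?thesis using l r by (simp add: a_minus_def)
  qed
  ultimately show ?thesis by (simp add: bullet_def)
qed

text \<open>By \<open>tensor_lift_comp\<close> only the defining forms need comparing. There the
  factor \<beta>\<beta> \<otimes> \<beta>\<beta> leaves both brackets, and it commutes with the
  twist because its two components are equal.\<close>

lemma balanceator_twisted:
  assumes t: "t \<in> carrier (tensor K A A)"
  shows "balanceator K A (\<beta> \<circ> \<mu>) (\<Delta> \<circ> \<beta>) (\<alpha> \<circ> \<beta>) t =
    tensor_map K A A A A (\<beta> \<circ> \<beta>) (\<beta> \<circ> \<beta>) (balanceator K A \<mu> \<Delta> \<alpha> t)"
  unfolding balanceator_def
proof (rule tensor_lift_comp[where h = "tensor_map K A A A A (\<beta> \<circ> \<beta>) (\<beta> \<circ> \<beta>)",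
      OF K A A tensor_module[OF K A A] tensor_module[OF K A A]
        balanceator_form_bilinear[OF K A \<mu> \<Delta> \<alpha>] _ _ t])
  have \<beta>\<beta>: "\<beta> \<circ> \<beta> \<in> module_hom K A A"
    using module_hom_comp[OF \<beta> \<beta>] by (simp add: comp_def)
  show h: "tensor_map K A A A A (\<beta> \<circ> \<beta>) (\<beta> \<circ> \<beta>) \<in> module_hom K (tensor K A A) (tensor K A A)"
    by (intro tensor_map_hom K A \<beta>\<beta>)
  fix x y assume x: "x \<in> carrier A" and y: "y \<in> carrier A"
  note op = module_hom_in_carrier[OF comult_op_hom[OF K A \<Delta>]]
  note b = bilinear_map_closed[OF bullet_bilinear[OF K A \<mu> \<alpha>]]
  show "bullet K A (\<beta> \<circ> \<mu>) (\<alpha> \<circ> \<beta>) x (comult_op K A (\<Delta> \<circ> \<beta>) y) \<oplus>\<^bsub>tensor K A A\<^esub>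
      twist K A (bullet K A (\<beta> \<circ> \<mu>) (\<alpha> \<circ> \<beta>) y (comult_op K A (\<Delta> \<circ> \<beta>) x)) =
    tensor_map K A A A A (\<beta> \<circ> \<beta>) (\<beta> \<circ> \<beta>)
      (bullet K A \<mu> \<alpha> x (comult_op K A \<Delta> y) \<oplus>\<^bsub>tensor K A A\<^esub>
       twist K A (bullet K A \<mu> \<alpha> y (comult_op K A \<Delta> x)))"
    by (simp add: comult_op_twisted bullet_twisted x y op b twist_tensor_map[OF K A A \<beta>\<beta> \<beta>\<beta>]
        module_hom_add[OF h] module_hom_in_carrier[OF twist_hom[OF K A]])
qed

end

section \<open>Powers of an endomorphism on the tensor square\<close>

lemma module_hom_funpow: "f \<in> module_hom K V V \<Longrightarrow> f ^^ n \<in> module_hom K V V"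
  by (induction n) (auto simp: module_hom_def Pi_def)

lemma tensor_map_funpow_Suc:
  assumes K: "cring K" and V: "module K V" and f: "f \<in> module_hom K V V"
    and t: "t \<in> carrier (tensor K V V)"
  shows "tensor_map K V V V V (f ^^ Suc n) (f ^^ Suc n) t =
    tensor_map K V V V V f f (tensor_map K V V V V (f ^^ n) (f ^^ n) t)"
  using tensor_map_comp[OF K V V V V V V module_hom_funpow[OF f] module_hom_funpow[OF f] f f t]
  by (simp add: comp_def)

text \<open>The map for exponent \<open>Suc n\<close> is the map for \<open>n\<close> followed by
  that of \<open>f\<close>, and injectivity passes to composites.\<close>

lemma inj_on_tensor_map_funpow:
  assumes K: "cring K" and V: "module K V" and f: "f \<in> module_hom K V V"
    and inj: "inj_on (tensor_map K V V V V f f) (carrier (tensor K V V))"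
  shows "inj_on (tensor_map K V V V V (f ^^ n) (f ^^ n)) (carrier (tensor K V V))"
proof (induction n)
  case 0
  show ?case using tensor_map_id[OF K V V] by (simp add: inj_on_def id_def)
next
  case (Suc n)
  \<comment> \<open>Injectivity of the outer map holds only on the carrier, so the inner map has to
    land there.\<close>
  have "tensor_map K V V V V (f ^^ n) (f ^^ n) t \<in> carrier (tensor K V V)"
    if "t \<in> carrier (tensor K V V)" for t
    by (intro module_hom_in_carrier[OF tensor_map_hom that] K V module_hom_funpow f)
  with Suc inj show ?case
    by (simp add: inj_on_def tensor_map_funpow_Suc[OF K V f] del: funpow.simps)
qed

section \<open>The derived bialgebra as a twist by a power of \<alpha>\<close>

context eps_hom_bialgebra
begin

lemma funpow_alpha_mult:
  assumes "x \<in> carrier A" "y \<in> carrier A"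
  shows "(\<alpha> ^^ n) (\<mu> (tens K A A x y)) = \<mu> (tens K A A ((\<alpha> ^^ n) x) ((\<alpha> ^^ n) y))"
proof (induction n)
  case (Suc n)
  have "(\<alpha> ^^ n) x \<in> carrier A" "(\<alpha> ^^ n) y \<in> carrier A"
    using module_hom_in_carrier[OF module_hom_funpow[OF alpha_hom]] assms by auto
  with Suc show ?case
    by (simp add: alpha_mult tens_closed tensor_map_tens module_axioms R.is_cring alpha_hom)
qed simp

lemma funpow_alpha_comult:
  assumes x: "x \<in> carrier A"
  shows "tensor_map K A A A A (\<alpha> ^^ n) (\<alpha> ^^ n) (\<Delta> x) = \<Delta> ((\<alpha> ^^ n) x)"
proof (induction n)
  case 0
  show ?case
    using tensor_map_id[OF R.is_cring module_axioms module_axioms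
        module_hom_in_carrier[OF comult_hom x]] by (simp add: id_def)
next
  case (Suc n)
  have "(\<alpha> ^^ n) x \<in> carrier A"
    using module_hom_in_carrier[OF module_hom_funpow[OF alpha_hom] x] .
  then show ?case
    using Suc tensor_map_funpow_Suc[OF R.is_cring module_axioms alpha_hom
        module_hom_in_carrier[OF comult_hom x], of n]
    by (simp add: alpha_comult comp_def)
qed

text \<open>Serves to keep values of the balanceator in the carrier, where injectivity can be
  applied.\<close>

lemma balanceator_hom:
  "balanceator K A \<mu> \<Delta> \<alpha> \<in> module_hom K (tensor K A A) (tensor K A A)"
  unfolding balanceator_def
  by (intro tensor_lift_hom balanceator_form_bilinear tensor_module R.is_cring module_axioms
      mult_hom comult_hom alpha_hom)

text \<open>The case \<open>\<beta> = \<alpha> ^^ (2 ^ n - 1)\<close> of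
  \<open>balanceator_twisted\<close>; the exponent doubles because \<open>\<beta>\<close> is applied
  twice to each factor.\<close>

lemma derived_balanceator_eq:
  assumes t: "t \<in> carrier (tensor K A A)"
  shows "derived_balanceator K A \<mu> \<Delta> \<alpha> n t =
    tensor_map K A A A A (\<alpha> ^^ (2 * (2 ^ n - 1))) (\<alpha> ^^ (2 * (2 ^ n - 1)))
      (balanceator K A \<mu> \<Delta> \<alpha> t)"
proof -
  let ?k = "2 ^ n - 1 :: nat"
  \<comment> \<open>Since \<open>2 ^ n\<close> is positive, the natural-number subtraction in
    \<open>?k\<close> is exact and \<open>Suc ?k = 2 ^ n\<close>.\<close>
  have "\<alpha> ^^ 2 ^ n = \<alpha> \<circ> \<alpha> ^^ ?k"
    using funpow.simps(2)[of ?k \<alpha>] by simp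
  moreover have "\<alpha> ^^ (2 * ?k) = \<alpha> ^^ ?k \<circ> \<alpha> ^^ ?k"
    by (simp only: mult_2 funpow_add)
  \<comment> \<open>The hypothesis left open by the rule application is that \<alpha> commutes with
    its own power.\<close>
  moreover have "balanceator K A (\<alpha> ^^ ?k \<circ> \<mu>) (\<Delta> \<circ> \<alpha> ^^ ?k) (\<alpha> \<circ> \<alpha> ^^ ?k) t =
    tensor_map K A A A A (\<alpha> ^^ ?k \<circ> \<alpha> ^^ ?k) (\<alpha> ^^ ?k \<circ> \<alpha> ^^ ?k) (balanceator K A \<mu> \<Delta> \<alpha> t)"
    by (rule balanceator_twisted[where \<beta> = "\<alpha> ^^ ?k", OF R.is_cring module_axioms mult_hom comult_hom alpha_hom
          module_hom_funpow[OF alpha_hom] funpow_alpha_mult funpow_alpha_comult _ t])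
      (simp_all add: funpow_swap1)
  ultimately show ?thesis
    by (simp add: derived_balanceator_def derived_mult_def derived_comult_def derived_alpha_def)
qed

end

theorem theorem6p9:
  fixes K :: "('k, 'm) ring_scheme" and A :: "('k, 'a, 'm1) module_scheme"
    and \<mu> :: "('a \<times> 'a \<Rightarrow> 'k) set \<Rightarrow> 'a"
    and \<Delta> :: "'a \<Rightarrow> ('a \<times> 'a \<Rightarrow> 'k) set"
    and \<alpha> :: "'a \<Rightarrow> 'a"
  assumes char_zero: "\<forall>m::nat. m > 0 \<longrightarrow> [m] \<cdot>\<^bsub>K\<^esub> \<one>\<^bsub>K\<^esub> \<noteq> \<zero>\<^bsub>K\<^esub>"
    and bialg: "eps_hom_bialgebra K A \<mu> \<Delta> \<alpha>"
  defines "B \<equiv> balanceator K A \<mu> \<Delta> \<alpha>"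
    and "Bn \<equiv> derived_balanceator K A \<mu> \<Delta> \<alpha>"
  shows "(\<forall>n\<ge>1. \<forall>t\<in>carrier (tensor K A A).
            Bn n t = tensor_map K A A A A (\<alpha> ^^ (2 * (2 ^ n - 1))) (\<alpha> ^^ (2 * (2 ^ n - 1))) (B t))
       \<and> (symmetric_map K A B \<longrightarrow> (\<forall>n\<ge>1. symmetric_map K A (Bn n)))
       \<and> ((\<exists>n\<ge>1. symmetric_map K A (Bn n)) \<and>
            inj_on (tensor_map K A A A A \<alpha> \<alpha>) (carrier (tensor K A A))
          \<longrightarrow> symmetric_map K A B)"
proof -
  interpret eps_hom_bialgebra K A \<mu> \<Delta> \<alpha> by (rule bialg)
  note tc = tens_closed[OF R.is_cring module_axioms module_axioms]
  note eq = derived_balanceator_eq[folded B_def Bn_def]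
  have Bc: "B t \<in> carrier (tensor K A A)" if "t \<in> carrier (tensor K A A)" for t
    using module_hom_in_carrier[OF balanceator_hom that] by (simp add: B_def)
  have "symmetric_map K A (Bn n)" if "symmetric_map K A B" for n
    using that by (simp add: symmetric_map_def eq tc)
  \<comment> \<open>By the formula for \<open>Bn n\<close>, the values of \<open>B\<close> at
    \<open>x\<close>, \<open>y\<close> in either order have equal images under a power of \<alpha>
    on both factors. That map is injective on the carrier and can be cancelled.\<close>
  moreover have "symmetric_map K A B"
    if "symmetric_map K A (Bn n)"
      "inj_on (tensor_map K A A A A \<alpha> \<alpha>) (carrier (tensor K A A))" for n
    using that(1) inj_onD[OF inj_on_tensor_map_funpow[OF R.is_cring module_axioms alpha_hom that(2)]
        _ Bc[OF tc] Bc[OF tc]]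
    by (simp add: symmetric_map_def eq tc) blast
  ultimately show ?thesis using eq by blast
qed

end
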